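(* In the splitting scheme, suppose $0\le\sigma^{n+1/2}\in L^\infty(\Omega)$ and $0\le r^{n+1/2}\le1$. Then after the diffusion step $0\le\sigma^{n+1}\le\|\sigma^{n+1/2}\|_{L^\infty(\Omega)}$ and $0\le r^{n+1}\le1$.
   Context: Setting. $\Omega\subset\mathbb R$ is a bounded open interval. $\chi:[0,\infty)\to\mathbb R$ is an internal energy density: $\chi\in C^0([0,\infty))\cap C^2((0,\infty))$, $\chi''>0$ on $(0,\infty)$, $\lim_{h\downarrow0}\chi'(h)=0$, and the integrals $\kappa(x):=\int_1^x\frac{\chi''(s)}{s}\,ds$, $K(\sigma):=\int_0^\sigma\kappa(x)\,dx$ exist. $\mathcal E(\rho,\eta):=\int_\Omega\chi(\rho+\eta)\,dx$. For $m>0$, $\mathcal P^m(\Omega)$ is the set of nonnegative Borel measures on $\Omega$ of mass $m$; $W_2$ is the quadratic Wasserstein distance, $W_2^2(\mu,\nu)=\inf_\gamma\int|x-y|^2d\gamma$ over couplings. Diffusion step of the splitting scheme with time step $\tau\in(0,1)$: given $r^{n+1/2}$, $\sigma^{n+1/2}$ on $\Omega$, set $\rho^{n+1/2}=r^{n+1/2}\sigma^{n+1/2}$, $\eta^{n+1/2}=(1-r^{n+1/2})\sigma^{n+1/2}$, $m_1=\int_\Omega\rho^{n+1/2}$, $m_2=\int_\Omega\eta^{n+1/2}$; let $(\rho^{n+1},\eta^{n+1})$ be a minimiser over $\mathcal P^{m_1}(\Omega)\times\mathcal P^{m_2}(\Omega)$ of $\frac1{2\tau}\big[W_2^2(\rho,\rho^{n+1/2})+W_2^2(\eta,\eta^{n+1/2})\big]+\mathcal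 E(\rho,\eta)$; set $\sigma^{n+1}=\rho^{n+1}+\eta^{n+1}$ and $r^{n+1}=r^{n+1/2}\circ\mathcal T$, where $\mathcal T$ is the nondecreasing optimal transport map pushing $\sigma^{n+1}$ forward to $\sigma^{n+1/2}$. *)

theory Defs
  imports "HOL-Analysis.Analysis" "HOL-Probability.Essential_Supremum"
begin

definition dens :: "real set \<Rightarrow> (real \<Rightarrow> real) \<Rightarrow> real measure" where
  "dens \<Omega> f = density lborel (\<lambda>x. ennreal (indicator \<Omega> x * f x))"

definition coupling :: "(real \<times> real) measure \<Rightarrow> real measure \<Rightarrow> real measure \<Rightarrow> bool" where
  "coupling \<gamma> \<mu> \<nu> \<longleftrightarrow> sets \<gamma> = sets (borel \<Otimes>\<^sub>M borel) \<and>
     distr \<gamma> borel fst = \<mu> \<and> distr \<gamma> borel snd = \<nu>"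

text \<open>Squared quadratic Wasserstein distance (finite here: all measures live on a bounded interval).\<close>
definition W2sq :: "real measure \<Rightarrow> real measure \<Rightarrow> real" where
  "W2sq \<mu> \<nu> = Inf {integral\<^sup>L \<gamma> (\<lambda>(x, y). (x - y)\<^sup>2) | \<gamma>. coupling \<gamma> \<mu> \<nu>}"

text \<open>Densities (representing elements of P^m(Omega)) of mass m, vanishing outside Omega.\<close>
definition adm_density :: "real set \<Rightarrow> real \<Rightarrow> (real \<Rightarrow> real) \<Rightarrow> bool" where
  "adm_density \<Omega> m f \<longleftrightarrow> f \<in> borel_measurable lborel \<and> (\<forall>x. 0 \<le> f x) \<and>
     (\<forall>x. x \<notin> \<Omega> \<longrightarrow> f x = 0) \<and> integrable lborel f \<and> integral\<^sup>L lborel f = m"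

definition energy_finite :: "(real \<Rightarrow> real) \<Rightarrow> real set \<Rightarrow> (real \<Rightarrow> real) \<Rightarrow> (real \<Rightarrow> real) \<Rightarrow> bool" where
  "energy_finite chi \<Omega> \<rho> \<eta> \<longleftrightarrow> set_integrable lborel \<Omega> (\<lambda>x. chi (\<rho> x + \<eta> x))"

definition energy :: "(real \<Rightarrow> real) \<Rightarrow> real set \<Rightarrow> (real \<Rightarrow> real) \<Rightarrow> (real \<Rightarrow> real) \<Rightarrow> real" where
  "energy chi \<Omega> \<rho> \<eta> = (LINT x:\<Omega>|lborel. chi (\<rho> x + \<eta> x))"

definition JKO_functional :: "(real \<Rightarrow> real) \<Rightarrow> real set \<Rightarrow> real \<Rightarrow> (real \<Rightarrow> real) \<Rightarrow> (real \<Rightarrow> real)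
    \<Rightarrow> (real \<Rightarrow> real) \<Rightarrow> (real \<Rightarrow> real) \<Rightarrow> real" where
  "JKO_functional chi \<Omega> \<tau> \<rho>h \<eta>h \<rho> \<eta> =
     (W2sq (dens \<Omega> \<rho>) (dens \<Omega> \<rho>h) + W2sq (dens \<Omega> \<eta>) (dens \<Omega> \<eta>h)) / (2 * \<tau>) + energy chi \<Omega> \<rho> \<eta>"

text \<open>(rho,eta) minimises the functional over P^{m1}(Omega) x P^{m2}(Omega). Competitors with
  infinite energy (in particular non-absolutely-continuous ones, E = +infinity) never beat a
  finite-energy competitor, so we minimise among finite-energy absolutely continuous pairs.\<close>
definition is_diffusion_minimiser :: "(real \<Rightarrow> real) \<Rightarrow> real set \<Rightarrow> real \<Rightarrow> (real \<Rightarrow> real) \<Rightarrow> (real \<Rightarrow> real)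
    \<Rightarrow> (real \<Rightarrow> real) \<Rightarrow> (real \<Rightarrow> real) \<Rightarrow> bool" where
  "is_diffusion_minimiser chi \<Omega> \<tau> \<rho>h \<eta>h \<rho> \<eta> \<longleftrightarrow>
     adm_density \<Omega> (integral\<^sup>L lborel \<rho>h) \<rho> \<and> adm_density \<Omega> (integral\<^sup>L lborel \<eta>h) \<eta> \<and>
     energy_finite chi \<Omega> \<rho> \<eta> \<and>
     (\<forall>\<rho>' \<eta>'. adm_density \<Omega> (integral\<^sup>L lborel \<rho>h) \<rho>' \<and> adm_density \<Omega> (integral\<^sup>L lborel \<eta>h) \<eta>' \<and>
        energy_finite chi \<Omega> \<rho>' \<eta>' \<longrightarrow>
        JKO_functional chi \<Omega> \<tau> \<rho>h \<eta>h \<rho> \<eta> \<le> JKO_functional chi \<Omega> \<tau> \<rho>h \<eta>h \<rho>' \<eta>')"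

definition kappa :: "(real \<Rightarrow> real) \<Rightarrow> real \<Rightarrow> real" where
  "kappa chi'' x = (LBINT s=1..x. chi'' s / s)"

end

theory Submission
  imports Defs "HOL-Probability.Probability_Mass_Function"
begin

text \<open>
  Let \<open>M\<close> be the essential supremum of the datum and suppose \<open>\<sigma> = \<rho> + \<eta>\<close> exceeds some \<open>t > M\<close> on a set
  of positive measure. Fix \<open>M < s < t\<close>, put \<open>A = {\<sigma> > s}\<close>, and in couplings of both species with their
  data move a fraction \<open>\<epsilon>\<close> of the mass starting in \<open>A\<close> all the way to its target. The moved mass no
  longer costs anything, so the transport terms do not increase. The arriving mass has a total
  density \<open>\<nu>\<close> below that of the datum, hence \<open>\<nu> \<le> M\<close>: mass is taken from where \<open>\<sigma>\<close>, and hence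
  \<open>chi' \<circ> \<sigma>\<close>, is large, and on \<open>A\<close> itself the density strictly decreases. By convexity the energy drops
  by an amount of order \<open>\<epsilon>\<close> that does not depend on the couplings, so almost optimal couplings suffice
  to contradict minimality.
\<close>

lemma dens_eq_density:
  assumes "\<And>x. x \<notin> \<Omega> \<Longrightarrow> f x = 0"
  shows "dens \<Omega> f = density lborel (\<lambda>x. ennreal (f x))"
proof -
  have "(\<lambda>x. ennreal (indicator \<Omega> x * f x)) = (\<lambda>x. ennreal (f x))"
    using assms by (auto simp: indicator_def)
  then show ?thesis by (simp add: dens_def)
qed

lemma coupling_exists:
  assumes "finite_measure \<mu>" "finite_measure \<nu>"
    and sets: "sets \<mu> = sets borel" "sets \<nu> = sets borel"
    and mass: "emeasure \<mu> UNIV = emeasure \<nu> UNIV"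
  shows "\<exists>\<gamma>. coupling \<gamma> \<mu> \<nu>"
proof -
  interpret \<mu>: finite_measure \<mu> by fact
  interpret \<nu>: finite_measure \<nu> by fact
  define m where "m = emeasure \<mu> UNIV"
  define \<gamma> where "\<gamma> = scale_measure (1 / m) (\<mu> \<Otimes>\<^sub>M \<nu>)"
  have [simp]: "space \<mu> = UNIV" "space \<nu> = UNIV"
    using sets_eq_imp_space_eq[OF sets(1)] sets_eq_imp_space_eq[OF sets(2)] by auto
  have m_fin: "m \<noteq> \<infinity>"
    using \<mu>.emeasure_finite by (simp add: m_def)
  have sg: "sets \<gamma> = sets (borel \<Otimes>\<^sub>M borel)"
    unfolding \<gamma>_def using sets_pair_measure_cong[OF sets] by simp
  have null: "emeasure \<mu> B = 0" "emeasure \<nu> B = 0" if "m = 0" for B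
    using that mass emeasure_mono[of B UNIV \<mu>] emeasure_mono[of B UNIV \<nu>]
      sets.top[of \<mu>] sets.top[of \<nu>] unfolding m_def by auto
  have cancel: "1 / m * (x * m) = x" if "m \<noteq> 0" for x
    using that m_fin
    by (metis ennreal_divide_times ennreal_mult_divide_eq infinity_ennreal_def mult.commute
        mult.right_neutral)
  have space: "space \<gamma> = UNIV"
    using sets_eq_imp_space_eq[OF sg] by (simp add: space_pair_measure)
  have "distr \<gamma> borel fst = \<mu>"
  proof (rule measure_eqI)
    fix B assume "B \<in> sets (distr \<gamma> borel fst)"
    then have B: "B \<in> sets borel" by simp
    have fst: "fst \<in> measurable \<gamma> borel"
      using measurable_cong_sets[OF sg refl] by blast
    have "fst -` B \<inter> space \<gamma> = B \<times> UNIV" by (auto simp: space)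
    then have "emeasure (distr \<gamma> borel fst) B = 1 / m * emeasure (\<mu> \<Otimes>\<^sub>M \<nu>) (B \<times> UNIV)"
      by (simp add: emeasure_distr[OF fst B]) (simp add: \<gamma>_def)
    also have "emeasure (\<mu> \<Otimes>\<^sub>M \<nu>) (B \<times> UNIV) = emeasure \<mu> B * m"
      using B sets mass by (subst \<nu>.emeasure_pair_measure_Times) (simp_all add: m_def)
    finally have "emeasure (distr \<gamma> borel fst) B = 1 / m * (emeasure \<mu> B * m)" .
    then show "emeasure (distr \<gamma> borel fst) B = emeasure \<mu> B"
      using cancel null by (cases "m = 0") auto
  qed (simp add: sets)
  moreover have "distr \<gamma> borel snd = \<nu>"
  proof (rule measure_eqI)
    fix B assume "B \<in> sets (distr \<gamma> borel snd)"
    then have B: "B \<in> sets borel" by simp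
    have snd: "snd \<in> measurable \<gamma> borel"
      using measurable_cong_sets[OF sg refl] by blast
    have "snd -` B \<inter> space \<gamma> = UNIV \<times> B" by (auto simp: space)
    then have "emeasure (distr \<gamma> borel snd) B = 1 / m * emeasure (\<mu> \<Otimes>\<^sub>M \<nu>) (UNIV \<times> B)"
      by (simp add: emeasure_distr[OF snd B]) (simp add: \<gamma>_def)
    also have "emeasure (\<mu> \<Otimes>\<^sub>M \<nu>) (UNIV \<times> B) = emeasure \<nu> B * m"
      using B sets mass by (subst \<nu>.emeasure_pair_measure_Times) (simp_all add: m_def mult.commute)
    finally have "emeasure (distr \<gamma> borel snd) B = 1 / m * (emeasure \<nu> B * m)" .
    then show "emeasure (distr \<gamma> borel snd) B = emeasure \<nu> B"
      using cancel null by (cases "m = 0") auto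
  qed (simp add: sets)
  ultimately show ?thesis
    using sg unfolding coupling_def by blast
qed

text \<open>Each particle of \<open>\<gamma>\<close> starting in \<open>A\<close> is, with probability \<open>\<epsilon>\<close>, moved to its target.\<close>
definition recoupling :: "(real \<times> real) measure \<Rightarrow> real set \<Rightarrow> real \<Rightarrow> (real \<times> real) measure" where
  "recoupling \<gamma> A \<epsilon> = distr (\<gamma> \<Otimes>\<^sub>M measure_pmf (bernoulli_pmf \<epsilon>)) (borel \<Otimes>\<^sub>M borel)
     (\<lambda>(z, u). if fst z \<in> A \<and> u then (snd z, snd z) else z)"

context
  fixes \<gamma> :: "(real \<times> real) measure" and A :: "real set" and \<epsilon> :: real
  assumes sets_\<gamma>: "sets \<gamma> = sets (borel \<Otimes>\<^sub>M borel)"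
    and A [measurable]: "A \<in> sets borel"
    and \<epsilon>: "0 \<le> \<epsilon>" "\<epsilon> \<le> 1"
begin

lemma measurable_recoupling_map:
  "(\<lambda>(z, u). if fst z \<in> A \<and> u then (snd z, snd z) else z)
     \<in> measurable (\<gamma> \<Otimes>\<^sub>M measure_pmf (bernoulli_pmf \<epsilon>)) (borel \<Otimes>\<^sub>M borel)"
proof -
  have eq: "sets (\<gamma> \<Otimes>\<^sub>M measure_pmf (bernoulli_pmf \<epsilon>))
      = sets ((borel \<Otimes>\<^sub>M borel) \<Otimes>\<^sub>M count_space UNIV)"
    by (rule sets_pair_measure_cong) (auto simp: sets_\<gamma>)
  show ?thesis
    unfolding measurable_cong_sets[OF eq refl] by measurable
qed

lemma nn_integral_recoupling:
  assumes [measurable]: "h \<in> borel_measurable (borel \<Otimes>\<^sub>M borel)"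
  shows "(\<integral>\<^sup>+ w. h w \<partial>recoupling \<gamma> A \<epsilon>) =
    (\<integral>\<^sup>+ z. (if fst z \<in> A then h (snd z, snd z) else h z) * ennreal \<epsilon> + h z * ennreal (1 - \<epsilon>) \<partial>\<gamma>)"
proof -
  let ?F = "\<lambda>(z, u). if fst z \<in> A \<and> u then (snd z, snd z) else (z :: real \<times> real)"
  let ?p = "measure_pmf (bernoulli_pmf \<epsilon>)"
  have "(\<integral>\<^sup>+ w. h w \<partial>recoupling \<gamma> A \<epsilon>) = (\<integral>\<^sup>+ w. h (?F w) \<partial>(\<gamma> \<Otimes>\<^sub>M ?p))"
    unfolding recoupling_def by (rule nn_integral_distr[OF measurable_recoupling_map]) simp
  also have "\<dots> = (\<integral>\<^sup>+ z. \<integral>\<^sup>+ u. h (?F (z, u)) \<partial>?p \<partial>\<gamma>)"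
    by (rule measure_pmf.nn_integral_fst[symmetric]) (rule measurable_compose[OF measurable_recoupling_map], simp)
  also have "\<dots> = (\<integral>\<^sup>+ z. (if fst z \<in> A then h (snd z, snd z) else h z) * ennreal \<epsilon> + h z * ennreal (1 - \<epsilon>) \<partial>\<gamma>)"
    using \<epsilon> by (intro nn_integral_cong) (auto simp: nn_integral_bernoulli_pmf)
  finally show ?thesis .
qed

end

lemma coupling_emeasure_marginals:
  assumes "coupling \<gamma> \<mu> \<nu>" "B \<in> sets borel"
  shows "emeasure \<gamma> (B \<times> UNIV) = emeasure \<mu> B" "emeasure \<gamma> (UNIV \<times> B) = emeasure \<nu> B"
proof -
  have sg: "sets \<gamma> = sets (borel \<Otimes>\<^sub>M borel)"
    and \<mu>: "distr \<gamma> borel fst = \<mu>" and \<nu>: "distr \<gamma> borel snd = \<nu>"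
    using assms(1) by (auto simp: coupling_def)
  have space: "space \<gamma> = UNIV"
    using sets_eq_imp_space_eq[OF sg] by (simp add: space_pair_measure)
  have m: "fst \<in> borel_measurable \<gamma>" "snd \<in> borel_measurable \<gamma>"
    using measurable_cong_sets[OF sg refl] by blast+
  have "fst -` B \<inter> space \<gamma> = B \<times> UNIV" "snd -` B \<inter> space \<gamma> = UNIV \<times> B"
    by (auto simp: space)
  then show "emeasure \<gamma> (B \<times> UNIV) = emeasure \<mu> B" "emeasure \<gamma> (UNIV \<times> B) = emeasure \<nu> B"
    using emeasure_distr[OF m(1) assms(2)] emeasure_distr[OF m(2) assms(2)] \<mu> \<nu> by simp_all
qed

lemma density_le_imp_AE_le:
  assumes [measurable]: "f \<in> borel_measurable M" "g \<in> borel_measurable M"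
    and fin: "(\<integral>\<^sup>+ x. g x \<partial>M) \<noteq> \<infinity>"
    and le: "\<And>B. B \<in> sets M \<Longrightarrow> emeasure (density M f) B \<le> emeasure (density M g) B"
  shows "AE x in M. f x \<le> g x"
proof (rule ccontr)
  assume neg: "\<not> (AE x in M. f x \<le> g x)"
  define B where "B = {x \<in> space M. g x < f x}"
  have [measurable]: "B \<in> sets M" unfolding B_def by measurable
  have "(\<integral>\<^sup>+ x. g x * indicator B x \<partial>M) < (\<integral>\<^sup>+ x. f x * indicator B x \<partial>M)"
  proof (rule nn_integral_less)
    have "(\<integral>\<^sup>+ x. g x * indicator B x \<partial>M) \<le> (\<integral>\<^sup>+ x. g x \<partial>M)"
      by (rule nn_integral_mono) (auto simp: indicator_def)
    then show "(\<integral>\<^sup>+ x. g x * indicator B x \<partial>M) \<noteq> \<infinity>"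
      using fin by (auto simp: top_unique)
    show "AE x in M. g x * indicator B x \<le> f x * indicator B x"
      by (auto simp: B_def indicator_def)
    show "\<not> (AE x in M. f x * indicator B x \<le> g x * indicator B x)"
    proof
      assume "AE x in M. f x * indicator B x \<le> g x * indicator B x"
      then have "AE x in M. f x \<le> g x"
        using AE_space
      proof eventually_elim
        case (elim x)
        then show ?case by (cases "g x < f x") (auto simp: B_def)
      qed
      with neg show False by contradiction
    qed
  qed simp_all
  moreover have "(\<integral>\<^sup>+ x. f x * indicator B x \<partial>M) \<le> (\<integral>\<^sup>+ x. g x * indicator B x \<partial>M)"
    using le[of B] by (simp add: emeasure_density)
  ultimately show False by simp
qed

lemma coupling_restricted_marginal_density:
  assumes \<gamma>: "coupling \<gamma> \<mu> (density lborel (\<lambda>x. ennreal (g x)))"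
    and A: "A \<in> sets borel"
    and g: "g \<in> borel_measurable borel" "\<And>x. 0 \<le> g x" "integrable lborel g"
  obtains n where "n \<in> borel_measurable borel" "\<And>x. 0 \<le> n x" "\<And>x. n x \<le> g x"
    "\<And>B. B \<in> sets borel \<Longrightarrow> emeasure \<gamma> (A \<times> B) = (\<integral>\<^sup>+ x. ennreal (n x) * indicator B x \<partial>lborel)"
proof -
  note [measurable] = A g(1)
  have sg: "sets \<gamma> = sets (borel \<Otimes>\<^sub>M borel)" using \<gamma> by (simp add: coupling_def)
  have space: "space \<gamma> = UNIV"
    using sets_eq_imp_space_eq[OF sg] by (simp add: space_pair_measure)
  define R where "R = density \<gamma> (indicator (A \<times> UNIV))"
  define N where "N = distr R borel snd"
  have AB: "A \<times> B \<in> sets \<gamma>" if "B \<in> sets borel" for B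
    using that A sg by simp
  have "snd \<in> borel_measurable R"
    unfolding R_def by (simp add: measurable_cong_sets[OF sg refl])
  then have N_eq: "emeasure N B = emeasure \<gamma> (A \<times> B)" if B: "B \<in> sets borel" for B
  proof -
    have UB: "UNIV \<times> B \<in> sets \<gamma>" "A \<times> UNIV \<in> sets \<gamma>" using B sg by simp_all
    have "snd -` B \<inter> space R = UNIV \<times> B" by (auto simp: R_def space)
    then have "emeasure N B = emeasure R (UNIV \<times> B)"
      unfolding N_def using emeasure_distr[OF \<open>snd \<in> borel_measurable R\<close> B] by simp
    also have "\<dots> = (\<integral>\<^sup>+ z. indicator (A \<times> UNIV) z * indicator (UNIV \<times> B) z \<partial>\<gamma>)"
      unfolding R_def using UB by (subst emeasure_density) auto
    also have "\<dots> = (\<integral>\<^sup>+ z. indicator (A \<times> B) z \<partial>\<gamma>)"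
      by (intro nn_integral_cong) (auto simp: indicator_def)
    also have "\<dots> = emeasure \<gamma> (A \<times> B)" using AB[OF B] by simp
    finally show ?thesis .
  qed
  have N_le: "emeasure N B \<le> emeasure (density lborel (\<lambda>x. ennreal (g x))) B" if B: "B \<in> sets borel" for B
  proof -
    have "emeasure \<gamma> (A \<times> B) \<le> emeasure \<gamma> (UNIV \<times> B)"
      using sg B by (intro emeasure_mono) auto
    then show ?thesis using N_eq[OF B] coupling_emeasure_marginals(2)[OF \<gamma> B] by simp
  qed
  have "absolutely_continuous lborel N"
    unfolding absolutely_continuous_def
  proof
    fix B assume B: "B \<in> null_sets (lborel :: real measure)"
    then have "B \<in> sets borel" by auto
    have "emeasure (density lborel (\<lambda>x. ennreal (g x))) B = 0"
      using B absolutely_continuousI_density[of "\<lambda>x. ennreal (g x)" lborel]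
      by (auto simp: absolutely_continuous_def null_sets_def)
    then show "B \<in> null_sets N"
      using N_le[OF \<open>B \<in> sets borel\<close>] \<open>B \<in> sets borel\<close> by (auto simp: null_sets_def N_def)
  qed
  then obtain f where f[measurable]: "f \<in> borel_measurable borel" and fN: "density lborel f = N"
    using sigma_finite_measure.Radon_Nikodym[OF sigma_finite_lborel, of N] by (auto simp: N_def)
  have "AE x in lborel. f x \<le> ennreal (g x)"
  proof (rule density_le_imp_AE_le)
    show "(\<integral>\<^sup>+ x. ennreal (g x) \<partial>lborel) \<noteq> \<infinity>"
      using g by (simp add: nn_integral_eq_integral)
  qed (use N_le fN in auto)
  then have ae: "AE x in lborel. f x = ennreal (min (enn2real (f x)) (g x))"
  proof eventually_elim
    case (elim x)
    then have "f x < top" using ennreal_less_top le_less_trans by blast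
    then have "ennreal (enn2real (f x)) = f x" by (rule ennreal_enn2real)
    then show ?case using elim g(2)[of x]
      by (metis enn2real_leI min.absorb1)
  qed
  show ?thesis
  proof (rule that[of "\<lambda>x. min (enn2real (f x)) (g x)"])
    fix B :: "real set" assume B: "B \<in> sets borel"
    have "emeasure \<gamma> (A \<times> B) = emeasure (density lborel f) B"
      using N_eq[OF B] fN by simp
    also have "\<dots> = (\<integral>\<^sup>+ x. f x * indicator B x \<partial>lborel)"
      using B by (subst emeasure_density) auto
    also have "\<dots> = (\<integral>\<^sup>+ x. ennreal (min (enn2real (f x)) (g x)) * indicator B x \<partial>lborel)"
      using ae by (intro nn_integral_cong_AE) auto
    finally show "emeasure \<gamma> (A \<times> B) = (\<integral>\<^sup>+ x. ennreal (min (enn2real (f x)) (g x)) * indicator B x \<partial>lborel)" .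
  qed (use g in auto)
qed

lemma coupling_recoupling:
  assumes \<gamma>: "coupling \<gamma> (density lborel (\<lambda>x. ennreal (f x))) \<nu>"
    and A: "A \<in> sets borel" and \<epsilon>: "0 \<le> \<epsilon>" "\<epsilon> \<le> 1"
    and f: "f \<in> borel_measurable borel" "\<And>x. 0 \<le> f x"
    and n: "n \<in> borel_measurable borel" "\<And>x. 0 \<le> n x"
      "\<And>B. B \<in> sets borel \<Longrightarrow> emeasure \<gamma> (A \<times> B) = (\<integral>\<^sup>+ x. ennreal (n x) * indicator B x \<partial>lborel)"
  shows "coupling (recoupling \<gamma> A \<epsilon>)
    (density lborel (\<lambda>x. ennreal ((1 - \<epsilon> * indicator A x) * f x + \<epsilon> * n x))) \<nu>"
proof -
  note [measurable] = A f(1) n(1)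
  let ?h = "\<lambda>x. (1 - \<epsilon> * indicator A x) * f x + \<epsilon> * n x"
  have sg: "sets \<gamma> = sets (borel \<Otimes>\<^sub>M borel)" and \<nu>: "distr \<gamma> borel snd = \<nu>"
    using \<gamma> by (auto simp: coupling_def)
  have sg_sets: "X \<times> Y \<in> sets \<gamma>" if "X \<in> sets borel" "Y \<in> sets borel" for X Y
    using that sg by simp
  have sr: "sets (recoupling \<gamma> A \<epsilon>) = sets (borel \<Otimes>\<^sub>M borel)"
    by (simp add: recoupling_def)
  have spr: "space (recoupling \<gamma> A \<epsilon>) = UNIV"
    by (simp add: recoupling_def space_pair_measure)
  have m: "fst \<in> borel_measurable (recoupling \<gamma> A \<epsilon>)" "snd \<in> borel_measurable (recoupling \<gamma> A \<epsilon>)"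
    using measurable_cong_sets[OF sr refl] by blast+
  have em: "emeasure (recoupling \<gamma> A \<epsilon>) (X \<times> Y) =
    (\<integral>\<^sup>+ z. (if fst z \<in> A then indicator (X \<times> Y) (snd z, snd z) else indicator (X \<times> Y) z) * ennreal \<epsilon>
       + indicator (X \<times> Y) z * ennreal (1 - \<epsilon>) \<partial>\<gamma>)" if XY: "X \<in> sets borel" "Y \<in> sets borel" for X Y
  proof -
    have "emeasure (recoupling \<gamma> A \<epsilon>) (X \<times> Y) = (\<integral>\<^sup>+ w. indicator (X \<times> Y) w \<partial>recoupling \<gamma> A \<epsilon>)"
      using XY sr by simp
    also have "\<dots> = (\<integral>\<^sup>+ z. (if fst z \<in> A then indicator (X \<times> Y) (snd z, snd z) else indicator (X \<times> Y) z) * ennreal \<epsilon>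
       + indicator (X \<times> Y) z * ennreal (1 - \<epsilon>) \<partial>\<gamma>)"
      using XY by (intro nn_integral_recoupling[OF sg A \<epsilon>]) auto
    finally show ?thesis .
  qed
  have \<epsilon>1: "ennreal \<epsilon> + ennreal (1 - \<epsilon>) = 1"
    using \<epsilon> by (simp flip: ennreal_plus)
  have "distr (recoupling \<gamma> A \<epsilon>) borel snd = \<nu>"
  proof (rule measure_eqI)
    fix B assume "B \<in> sets (distr (recoupling \<gamma> A \<epsilon>) borel snd)"
    then have B: "B \<in> sets borel" by simp
    have "snd -` B \<inter> space (recoupling \<gamma> A \<epsilon>) = UNIV \<times> B" by (auto simp: spr)
    then have "emeasure (distr (recoupling \<gamma> A \<epsilon>) borel snd) B = emeasure (recoupling \<gamma> A \<epsilon>) (UNIV \<times> B)"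
      by (simp add: emeasure_distr[OF m(2) B])
    also have "\<dots> = (\<integral>\<^sup>+ z. indicator (UNIV \<times> B) z \<partial>\<gamma>)"
      using B \<epsilon>1 by (subst em) (auto intro!: nn_integral_cong simp: indicator_def)
    also have "\<dots> = emeasure \<nu> B"
      using sg_sets[of UNIV B] B coupling_emeasure_marginals(2)[OF \<gamma> B] by simp
    finally show "emeasure (distr (recoupling \<gamma> A \<epsilon>) borel snd) B = emeasure \<nu> B" .
  qed (use \<nu> in auto)
  moreover have "distr (recoupling \<gamma> A \<epsilon>) borel fst = density lborel (\<lambda>x. ennreal (?h x))"
  proof (rule measure_eqI)
    fix B assume "B \<in> sets (distr (recoupling \<gamma> A \<epsilon>) borel fst)"
    then have B[measurable]: "B \<in> sets borel" by simp
    have [measurable]: "A \<times> B \<in> sets \<gamma>" "(B - A) \<times> UNIV \<in> sets \<gamma>" "B \<times> UNIV \<in> sets \<gamma>"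
      by (auto intro!: sg_sets)
    have f_em: "emeasure \<gamma> (C \<times> UNIV) = (\<integral>\<^sup>+ x. ennreal (f x) * indicator C x \<partial>lborel)"
      if "C \<in> sets borel" for C
      using that coupling_emeasure_marginals(1)[OF \<gamma> that] by (simp add: emeasure_density)
    have "fst -` B \<inter> space (recoupling \<gamma> A \<epsilon>) = B \<times> UNIV" by (auto simp: spr)
    then have "emeasure (distr (recoupling \<gamma> A \<epsilon>) borel fst) B = emeasure (recoupling \<gamma> A \<epsilon>) (B \<times> UNIV)"
      by (simp add: emeasure_distr[OF m(1) B])
    also have "\<dots> = (\<integral>\<^sup>+ z. ennreal \<epsilon> * indicator (A \<times> B) z
        + (ennreal \<epsilon> * indicator ((B - A) \<times> UNIV) z + ennreal (1 - \<epsilon>) * indicator (B \<times> UNIV) z) \<partial>\<gamma>)"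
      using B by (subst em) (auto intro!: nn_integral_cong simp: indicator_def)
    also have "\<dots> = ennreal \<epsilon> * emeasure \<gamma> (A \<times> B)
        + (ennreal \<epsilon> * emeasure \<gamma> ((B - A) \<times> UNIV) + ennreal (1 - \<epsilon>) * emeasure \<gamma> (B \<times> UNIV))"
      by (simp add: nn_integral_add nn_integral_cmult)
    also have "\<dots> = (\<integral>\<^sup>+ x. ennreal \<epsilon> * (ennreal (n x) * indicator B x)
        + (ennreal \<epsilon> * (ennreal (f x) * indicator (B - A) x)
           + ennreal (1 - \<epsilon>) * (ennreal (f x) * indicator B x)) \<partial>lborel)"
      using f_em[of "B - A"] f_em[of B] n(3)[OF B] by (simp add: nn_integral_add nn_integral_cmult)
    also have "\<dots> = (\<integral>\<^sup>+ x. ennreal (?h x) * indicator B x \<partial>lborel)"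
    proof (intro nn_integral_cong)
      fix x
      have "ennreal (?h x) = ennreal \<epsilon> * ennreal (n x)
        + (ennreal \<epsilon> * (ennreal (f x) * indicator (- A) x) + ennreal (1 - \<epsilon>) * ennreal (f x))"
      proof -
        have "?h x = \<epsilon> * n x + (\<epsilon> * (f x * indicator (- A) x) + (1 - \<epsilon>) * f x)"
          by (auto simp: indicator_def algebra_simps)
        then show ?thesis
          using f(2)[of x] n(2)[of x] \<epsilon> by (simp add: ennreal_plus ennreal_mult ennreal_indicator)
      qed
      then show "ennreal \<epsilon> * (ennreal (n x) * indicator B x)
        + (ennreal \<epsilon> * (ennreal (f x) * indicator (B - A) x)
           + ennreal (1 - \<epsilon>) * (ennreal (f x) * indicator B x)) = ennreal (?h x) * indicator B x"
        by (auto simp: indicator_def)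
    qed
    also have "\<dots> = emeasure (density lborel (\<lambda>x. ennreal (?h x))) B"
      by (simp add: emeasure_density)
    finally show "emeasure (distr (recoupling \<gamma> A \<epsilon>) borel fst) B
      = emeasure (density lborel (\<lambda>x. ennreal (?h x))) B" .
  qed simp
  ultimately show ?thesis using sr by (simp add: coupling_def)
qed

lemma coupling_cost_finite:
  assumes \<gamma>: "coupling \<gamma> \<mu> \<nu>" and "emeasure \<mu> UNIV \<noteq> \<infinity>"
    and null: "emeasure \<mu> (- {a<..<b}) = 0" "emeasure \<nu> (- {a<..<b}) = 0"
  shows "(\<integral>\<^sup>+ z. ennreal ((fst z - snd z)\<^sup>2) \<partial>\<gamma>) < top"
proof -
  have sg: "sets \<gamma> = sets (borel \<Otimes>\<^sub>M borel)"
    using \<gamma> by (simp add: coupling_def)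
  have space: "space \<gamma> = UNIV"
    using sets_eq_imp_space_eq[OF sg] by (simp add: space_pair_measure)
  have "AE z in \<gamma>. ennreal ((fst z - snd z)\<^sup>2) \<le> ennreal ((b - a)\<^sup>2)"
  proof (rule AE_I')
    show "(- {a<..<b}) \<times> UNIV \<union> UNIV \<times> (- {a<..<b}) \<in> null_sets \<gamma>"
      using null coupling_emeasure_marginals[OF \<gamma>, of "- {a<..<b}"] sg
      by (intro null_sets.Un) (auto simp: null_sets_def)
    have "(x - y)\<^sup>2 \<le> (b - a)\<^sup>2" if "x \<in> {a<..<b}" "y \<in> {a<..<b}" for x y
      using that by (intro power2_le_iff_abs_le[THEN iffD2]) auto
    then show "{z \<in> space \<gamma>. \<not> ennreal ((fst z - snd z)\<^sup>2) \<le> ennreal ((b - a)\<^sup>2)}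
        \<subseteq> (- {a<..<b}) \<times> UNIV \<union> UNIV \<times> (- {a<..<b})"
      by (force intro: ennreal_leI)
  qed
  then have "(\<integral>\<^sup>+ z. ennreal ((fst z - snd z)\<^sup>2) \<partial>\<gamma>) \<le> (\<integral>\<^sup>+ z. ennreal ((b - a)\<^sup>2) \<partial>\<gamma>)"
    by (rule nn_integral_mono_AE)
  also have "\<dots> = ennreal ((b - a)\<^sup>2) * emeasure \<mu> UNIV"
    using coupling_emeasure_marginals(1)[OF \<gamma>, of UNIV] space by simp
  also have "\<dots> < top"
    using assms(2) by (simp add: ennreal_mult_less_top top.not_eq_extremum)
  finally show ?thesis .
qed

lemma coupling_cost_eq_nn_integral:
  assumes "sets \<gamma> = sets (borel \<Otimes>\<^sub>M borel)"
  shows "integral\<^sup>L \<gamma> (\<lambda>(x, y). (x - y)\<^sup>2) = enn2real (\<integral>\<^sup>+ z. ennreal ((fst z - snd z)\<^sup>2) \<partial>\<gamma>)"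
  unfolding split_beta'
  by (rule integral_eq_nn_integral) (simp_all add: measurable_cong_sets[OF assms refl])

lemma W2sq_le:
  assumes "coupling \<gamma> \<mu> \<nu>"
  shows "W2sq \<mu> \<nu> \<le> integral\<^sup>L \<gamma> (\<lambda>(x, y). (x - y)\<^sup>2)"
  unfolding W2sq_def
proof (rule cInf_lower)
  show "bdd_below {integral\<^sup>L \<gamma> (\<lambda>(x, y). (x - y)\<^sup>2) | \<gamma>. coupling \<gamma> \<mu> \<nu>}"
    by (rule bdd_belowI[of _ 0]) (auto intro!: integral_nonneg_AE)
qed (use assms in blast)

lemma adm_density_dens:
  assumes "adm_density \<Omega> m f"
  shows "dens \<Omega> f = density lborel (\<lambda>x. ennreal (f x))"
    and "emeasure (dens \<Omega> f) UNIV = ennreal m"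
    and "\<Omega> \<in> sets borel \<Longrightarrow> emeasure (dens \<Omega> f) (- \<Omega>) = 0"
proof -
  have f: "f \<in> borel_measurable borel" "\<And>x. 0 \<le> f x" "\<And>x. x \<notin> \<Omega> \<Longrightarrow> f x = 0"
      "integrable lborel f" "integral\<^sup>L lborel f = m"
    using assms by (auto simp: adm_density_def)
  show eq: "dens \<Omega> f = density lborel (\<lambda>x. ennreal (f x))"
    using f(3) by (rule dens_eq_density)
  show "emeasure (dens \<Omega> f) UNIV = ennreal m"
    using f by (simp add: eq emeasure_density nn_integral_eq_integral)
  show "emeasure (dens \<Omega> f) (- \<Omega>) = 0" if "\<Omega> \<in> sets borel"
  proof -
    have "emeasure (dens \<Omega> f) (- \<Omega>) = (\<integral>\<^sup>+ x. ennreal (f x) * indicator (- \<Omega>) x \<partial>lborel)"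
      using that f(1) by (simp add: eq emeasure_density)
    also have "\<dots> = (\<integral>\<^sup>+ x. 0 \<partial>(lborel :: real measure))"
      by (intro nn_integral_cong) (use f(3) in \<open>auto simp: indicator_def\<close>)
    finally show ?thesis by simp
  qed
qed

text \<open>The moved particles sit on their targets and cost nothing, so the transport cost does not
  increase; and the mass arriving at the targets has a density \<open>n\<close> dominated by that of the target
  measure. The slack \<open>\<delta>\<close> replaces the existence of optimal couplings.\<close>
lemma move_mass_to_target:
  assumes f: "adm_density {a<..<b} m f" and g: "adm_density {a<..<b} m g"
    and A[measurable]: "A \<in> sets borel" and \<epsilon>: "0 \<le> \<epsilon>" "\<epsilon> \<le> 1" and \<delta>: "0 < \<delta>"
  obtains n where "n \<in> borel_measurable borel" "\<And>x. 0 \<le> n x" "\<And>x. n x \<le> g x"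
    "integrable lborel n" "integral\<^sup>L lborel n = (\<integral>x. indicator A x * f x \<partial>lborel)"
    "adm_density {a<..<b} m (\<lambda>x. (1 - \<epsilon> * indicator A x) * f x + \<epsilon> * n x)"
    "W2sq (dens {a<..<b} (\<lambda>x. (1 - \<epsilon> * indicator A x) * f x + \<epsilon> * n x)) (dens {a<..<b} g)
      \<le> W2sq (dens {a<..<b} f) (dens {a<..<b} g) + \<delta>"
proof -
  let ?\<Omega> = "{a<..<b}"
  let ?c = "\<lambda>(x, y). (x - y)\<^sup>2 :: real"
  have f': "f \<in> borel_measurable borel" "\<And>x. 0 \<le> f x" "\<And>x. x \<notin> ?\<Omega> \<Longrightarrow> f x = 0"
      "integrable lborel f" "integral\<^sup>L lborel f = m"
    using f by (auto simp: adm_density_def)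
  have g': "g \<in> borel_measurable borel" "\<And>x. 0 \<le> g x" "\<And>x. x \<notin> ?\<Omega> \<Longrightarrow> g x = 0"
      "integrable lborel g"
    using g by (auto simp: adm_density_def)
  note [measurable] = f'(1) g'(1)
  note df = adm_density_dens[OF f] and dg = adm_density_dens[OF g]
  have "\<exists>\<gamma>. coupling \<gamma> (dens ?\<Omega> f) (dens ?\<Omega> g)"
    using df dg by (intro coupling_exists finite_measureI) (auto simp: dens_def)
  moreover have "Inf {integral\<^sup>L \<gamma> ?c | \<gamma>. coupling \<gamma> (dens ?\<Omega> f) (dens ?\<Omega> g)}
      < W2sq (dens ?\<Omega> f) (dens ?\<Omega> g) + \<delta>"
    using \<delta> by (simp add: W2sq_def)
  ultimately obtain \<gamma> where \<gamma>: "coupling \<gamma> (dens ?\<Omega> f) (dens ?\<Omega> g)"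
    and \<gamma>_cost: "integral\<^sup>L \<gamma> ?c < W2sq (dens ?\<Omega> f) (dens ?\<Omega> g) + \<delta>"
    using cInf_lessD[of "{integral\<^sup>L \<gamma> ?c | \<gamma>. coupling \<gamma> (dens ?\<Omega> f) (dens ?\<Omega> g)}"] by blast
  have sg: "sets \<gamma> = sets (borel \<Otimes>\<^sub>M borel)" using \<gamma> by (simp add: coupling_def)
  obtain n where n: "n \<in> borel_measurable borel" "\<And>x. 0 \<le> n x" "\<And>x. n x \<le> g x"
    "\<And>B. B \<in> sets borel \<Longrightarrow> emeasure \<gamma> (A \<times> B) = (\<integral>\<^sup>+ x. ennreal (n x) * indicator B x \<partial>lborel)"
    using coupling_restricted_marginal_density[OF \<gamma>[unfolded dg(1)] A g'(1,2,4)] by blast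
  note [measurable] = n(1)
  let ?h = "\<lambda>x. (1 - \<epsilon> * indicator A x) * f x + \<epsilon> * n x"
  have n_int: "integrable lborel n"
    by (rule Bochner_Integration.integrable_bound[OF g'(4)]) (use n g' in auto)
  have fA_int: "integrable lborel (\<lambda>x. indicator A x * f x)"
    by (rule Bochner_Integration.integrable_bound[OF f'(4)]) (auto simp: indicator_def)
  have n_mass: "integral\<^sup>L lborel n = (\<integral>x. indicator A x * f x \<partial>lborel)"
  proof -
    have "ennreal (integral\<^sup>L lborel n) = (\<integral>\<^sup>+ x. ennreal (n x) \<partial>lborel)"
      using n n_int by (simp add: nn_integral_eq_integral)
    also have "\<dots> = emeasure (dens ?\<Omega> f) A"
      using n(4)[of UNIV] coupling_emeasure_marginals(1)[OF \<gamma> A] by simp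
    also have "\<dots> = (\<integral>\<^sup>+ x. ennreal (indicator A x * f x) \<partial>lborel)"
      unfolding df(1) by (simp add: emeasure_density)
        (auto intro!: nn_integral_cong simp: indicator_def)
    also have "\<dots> = ennreal (\<integral>x. indicator A x * f x \<partial>lborel)"
      using f' fA_int by (intro nn_integral_eq_integral) auto
    finally show ?thesis
      using n(2) f'(2) by (subst (asm) ennreal_inj) (auto intro!: integral_nonneg_AE)
  qed
  have h_eq: "?h = (\<lambda>x. f x - \<epsilon> * (indicator A x * f x) + \<epsilon> * n x)"
    by (auto simp: algebra_simps)
  have n_0: "n x = 0" if "x \<notin> ?\<Omega>" for x
    using n(2,3)[of x] g'(3)[OF that] by simp
  have adm: "adm_density ?\<Omega> m ?h"
    unfolding adm_density_def
  proof (intro conjI allI impI)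
    show "integrable lborel ?h"
      unfolding h_eq using f'(4) fA_int n_int by simp
    show "integral\<^sup>L lborel ?h = m"
      unfolding h_eq using f'(4,5) fA_int n_int n_mass by simp
    show "0 \<le> ?h x" for x
      using f'(2)[of x] n(2)[of x] \<epsilon> by (auto simp: indicator_def)
  qed (use f' n_0 in auto)
  note dh = adm_density_dens[OF adm]
  have rec: "coupling (recoupling \<gamma> A \<epsilon>) (dens ?\<Omega> ?h) (dens ?\<Omega> g)"
    unfolding dh(1) by (rule coupling_recoupling[OF \<gamma>[unfolded df(1)] A \<epsilon> f'(1,2) n(1,2,4)])
  have "(\<integral>\<^sup>+ z. ennreal ((fst z - snd z)\<^sup>2) \<partial>recoupling \<gamma> A \<epsilon>) =
     (\<integral>\<^sup>+ z. (if fst z \<in> A then ennreal ((fst (snd z, snd z) - snd (snd z, snd z))\<^sup>2) else ennreal ((fst z - snd z)\<^sup>2)) * ennreal \<epsilon>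
        + ennreal ((fst z - snd z)\<^sup>2) * ennreal (1 - \<epsilon>) \<partial>\<gamma>)"
    by (rule nn_integral_recoupling[OF sg A \<epsilon>]) measurable
  also have "\<dots> \<le> (\<integral>\<^sup>+ z. ennreal ((fst z - snd z)\<^sup>2) \<partial>\<gamma>)"
  proof (rule nn_integral_mono)
    fix z :: "real \<times> real"
    let ?d = "ennreal ((fst z - snd z)\<^sup>2)"
    have "(if fst z \<in> A then ennreal ((fst (snd z, snd z) - snd (snd z, snd z))\<^sup>2) else ?d) * ennreal \<epsilon>
        + ?d * ennreal (1 - \<epsilon>) \<le> ?d * ennreal \<epsilon> + ?d * ennreal (1 - \<epsilon>)"
      by (intro add_right_mono mult_right_mono) auto
    also have "\<dots> = ?d * (ennreal \<epsilon> + ennreal (1 - \<epsilon>))"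
      by (simp only: distrib_left)
    also have "\<dots> = ?d"
      using \<epsilon> by (simp flip: ennreal_plus)
    finally show "(if fst z \<in> A then ennreal ((fst (snd z, snd z) - snd (snd z, snd z))\<^sup>2) else ?d) * ennreal \<epsilon>
        + ?d * ennreal (1 - \<epsilon>) \<le> ?d" .
  qed
  finally have "integral\<^sup>L (recoupling \<gamma> A \<epsilon>) ?c \<le> integral\<^sup>L \<gamma> ?c"
    using coupling_cost_finite[OF \<gamma>, of a b] df dg
    by (simp add: coupling_cost_eq_nn_integral sg recoupling_def enn2real_mono)
  then have "W2sq (dens ?\<Omega> ?h) (dens ?\<Omega> g) \<le> W2sq (dens ?\<Omega> f) (dens ?\<Omega> g) + \<delta>"
    using W2sq_le[OF rec] \<gamma>_cost by linarith
  then show ?thesis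
    using that n(1-3) n_int n_mass adm by blast
qed

context
  fixes chi chi' chi'' :: "real \<Rightarrow> real"
  assumes chi_cont: "continuous_on {0..} chi"
    and chi_d1: "\<And>h. 0 < h \<Longrightarrow> (chi has_real_derivative chi' h) (at h)"
    and chi_d2: "\<And>h. 0 < h \<Longrightarrow> (chi' has_real_derivative chi'' h) (at h)"
    and chi_convex: "\<And>h. 0 < h \<Longrightarrow> 0 < chi'' h"
begin

lemma deriv_strict_mono:
  assumes "0 < x" "x < y"
  shows "chi' x < chi' y"
  using assms(2)
proof (rule DERIV_pos_imp_increasing)
  fix z assume "x \<le> z" "z \<le> y"
  then show "\<exists>D. (chi' has_real_derivative D) (at z) \<and> 0 < D"
    using assms(1) chi_d2[of z] chi_convex[of z] by auto
qed

lemma deriv_mono: "0 < x \<Longrightarrow> x \<le> y \<Longrightarrow> chi' x \<le> chi' y"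
  using deriv_strict_mono[of x y] by (cases "x = y") auto

lemma mean_value:
  assumes "0 \<le> x" "x < w"
  obtains z where "x < z" "z < w" "chi w - chi x = (w - x) * chi' z"
proof -
  have "continuous_on {x..w} chi"
    using chi_cont assms by (auto intro: continuous_on_subset)
  moreover have "chi differentiable (at z)" if "x < z" "z < w" for z
    using chi_d1[of z] that assms by (auto simp: real_differentiable_def)
  ultimately obtain l z where z: "x < z" "z < w" "(chi has_real_derivative l) (at z)"
      "chi w - chi x = (w - x) * l"
    using MVT[OF assms(2), of chi] by blast
  then have "l = chi' z"
    using DERIV_unique[OF z(3) chi_d1[of z]] assms by auto
  then show ?thesis using that z by blast
qed

lemma slope_le:
  assumes "0 \<le> x" "x \<le> w" "w \<le> z" "0 < z"
  shows "chi w - chi x \<le> chi' z * (w - x)"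
proof (cases "x = w")
  case False
  then obtain u where "x < u" "u < w" "chi w - chi x = (w - x) * chi' u"
    using mean_value[of x w] assms by auto
  then show ?thesis
    using deriv_mono[of u z] assms by (simp add: mult.commute mult_right_mono)
qed simp

lemma slope_ge:
  assumes "0 < z" "z \<le> w" "w \<le> x"
  shows "chi w - chi x \<le> chi' z * (w - x)"
proof (cases "x = w")
  case False
  then obtain u where u: "w < u" "u < x" "chi x - chi w = (x - w) * chi' u"
    using mean_value[of w x] assms by auto
  then have "(x - w) * chi' z \<le> (x - w) * chi' u"
    using deriv_mono[of z u] assms by (intro mult_left_mono) auto
  then show ?thesis using u(3) by (simp add: algebra_simps)
qed simp

lemma energy_density_mono:
  assumes "(chi' \<longlongrightarrow> 0) (at_right 0)" and "0 \<le> x" "x \<le> y"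
  shows "chi x \<le> chi y"
proof (cases "x = y")
  case False
  then obtain u where u: "x < u" "u < y" "chi y - chi x = (y - x) * chi' u"
    using mean_value[of x y] assms by auto
  have "0 \<le> chi' u"
  proof (rule tendsto_upperbound[OF assms(1)])
    have "\<forall>\<^sub>F h in at_right 0. h \<in> {0<..<u}"
      using u(1) assms(2) by (intro eventually_at_right_real) auto
    then show "\<forall>\<^sub>F h in at_right 0. chi' h \<le> chi' u"
      by eventually_elim (auto intro: deriv_mono)
  qed simp
  then show ?thesis
    using u assms by (metis diff_ge_0_iff_ge mult_nonneg_nonneg)
qed simp

lemma exists_decreasing_fraction:
  assumes "0 \<le> M" "M < s" "s < t" "0 < L"
  obtains \<epsilon> where "0 < \<epsilon>" "\<epsilon> < 1"
    "(chi' (s + \<epsilon> * M) - chi' ((1 - \<epsilon>) * s)) * S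
       < (chi' ((1 - \<epsilon>) * t) - chi' (s + \<epsilon> * M)) * ((t - M) * L)"
proof -
  let ?F = "\<lambda>\<epsilon>. (chi' (s + \<epsilon> * M) - chi' ((1 - \<epsilon>) * s)) * S
       - (chi' ((1 - \<epsilon>) * t) - chi' (s + \<epsilon> * M)) * ((t - M) * L)"
  have pos: "0 < s" "0 < t" using assms by auto
  have c: "isCont chi' s" "isCont chi' t"
    using DERIV_isCont[OF chi_d2] pos by auto
  have "((\<lambda>\<epsilon>. s + \<epsilon> * M) \<longlongrightarrow> s) (at_right 0)" "((\<lambda>\<epsilon>. (1 - \<epsilon>) * s) \<longlongrightarrow> s) (at_right 0)"
    "((\<lambda>\<epsilon>. (1 - \<epsilon>) * t) \<longlongrightarrow> t) (at_right 0)"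
    by (auto intro!: tendsto_eq_intros)
  then have "(?F \<longlongrightarrow> (chi' s - chi' s) * S - (chi' t - chi' s) * ((t - M) * L)) (at_right 0)"
    by (intro tendsto_intros isCont_tendsto_compose[OF c(1)] isCont_tendsto_compose[OF c(2)])
  moreover have "(chi' s - chi' s) * S - (chi' t - chi' s) * ((t - M) * L) < 0"
    using deriv_strict_mono[of s t] pos assms by simp
  ultimately have "\<forall>\<^sub>F \<epsilon> in at_right 0. ?F \<epsilon> < 0"
    by (rule order_tendstoD(2))
  moreover have "\<forall>\<^sub>F \<epsilon> in at_right (0::real). \<epsilon> \<in> {0<..<1}"
    by (rule eventually_at_right_real) simp
  ultimately have "\<forall>\<^sub>F \<epsilon> in at_right 0. ?F \<epsilon> < 0 \<and> \<epsilon> \<in> {0<..<1}"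
    by (rule eventually_conj)
  then obtain \<epsilon> where "?F \<epsilon> < 0 \<and> \<epsilon> \<in> {0<..<1}"
    using eventually_happens'[of "at_right (0::real)"] by (auto simp: trivial_limit_at_right_real)
  then show ?thesis using that[of \<epsilon>] by simp
qed

lemma pointwise_energy_change:
  assumes M: "0 \<le> M" "M < s" "s < t" and \<epsilon>: "0 < \<epsilon>" "\<epsilon> < 1"
    and \<nu>: "0 \<le> \<nu>" "\<nu> \<le> M" and \<sigma>: "0 \<le> \<sigma>"
    and c: "c\<^sub>0 = chi' (s + \<epsilon> * M)" "c\<^sub>1 = chi' ((1 - \<epsilon>) * s)" "c\<^sub>2 = chi' ((1 - \<epsilon>) * t)" "c\<^sub>0 \<le> c\<^sub>2"
  shows "chi ((1 - \<epsilon> * of_bool (s < \<sigma>)) * \<sigma> + \<epsilon> * \<nu>) - chi \<sigma>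
    \<le> \<epsilon> * (c\<^sub>0 * (\<nu> - of_bool (s < \<sigma>) * \<sigma>) + (c\<^sub>0 - c\<^sub>1) * (of_bool (s < \<sigma>) * \<sigma>)
        - (c\<^sub>2 - c\<^sub>0) * (t - M) * of_bool (t < \<sigma>))"
proof (cases "s < \<sigma>")
  case False
  have "\<epsilon> * \<nu> \<le> \<epsilon> * M" "0 \<le> \<epsilon> * \<nu>" "0 \<le> \<epsilon> * M" using \<epsilon> \<nu> M by (auto intro: mult_left_mono)
  then have "chi (\<sigma> + \<epsilon> * \<nu>) - chi \<sigma> \<le> c\<^sub>0 * (\<sigma> + \<epsilon> * \<nu> - \<sigma>)"
    unfolding c using False M \<sigma> by (intro slope_le) auto
  then show ?thesis using False M by (simp add: algebra_simps)
next
  case True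
  let ?w = "(1 - \<epsilon>) * \<sigma> + \<epsilon> * \<nu>"
  have w\<sigma>: "?w - \<sigma> = - (\<epsilon> * (\<sigma> - \<nu>))" by (simp add: algebra_simps)
  have "\<nu> < \<sigma>" using True M \<nu> by simp
  then have "0 \<le> \<epsilon> * (\<sigma> - \<nu>)" using \<epsilon> by simp
  then have w_le: "?w \<le> \<sigma>" using w\<sigma> by simp
  have \<epsilon>\<nu>: "0 \<le> \<epsilon> * \<nu>" using \<epsilon> \<nu> by simp
  have pos: "0 < s" "0 < t" using M by auto
  have c01: "c\<^sub>1 \<le> c\<^sub>0"
  proof -
    have "0 \<le> \<epsilon> * s" "0 \<le> \<epsilon> * M" using \<epsilon> M by auto
    then show ?thesis
      unfolding c using \<epsilon> pos by (intro deriv_mono) (auto simp: algebra_simps)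
  qed
  show ?thesis
  proof (cases "t < \<sigma>")
    case False
    have "(1 - \<epsilon>) * s \<le> (1 - \<epsilon>) * \<sigma>" using True \<epsilon> by (intro mult_left_mono) auto
    then have "(1 - \<epsilon>) * s \<le> ?w" using \<epsilon>\<nu> by linarith
    then have "chi ?w - chi \<sigma> \<le> c\<^sub>1 * (?w - \<sigma>)"
      unfolding c using \<epsilon> pos by (intro slope_ge[OF _ _ w_le]) auto
    also have "\<dots> = \<epsilon> * (c\<^sub>0 * (\<nu> - \<sigma>) + (c\<^sub>0 - c\<^sub>1) * \<sigma>) - \<epsilon> * ((c\<^sub>0 - c\<^sub>1) * \<nu>)"
      unfolding w\<sigma> by (simp add: algebra_simps)
    also have "\<dots> \<le> \<epsilon> * (c\<^sub>0 * (\<nu> - \<sigma>) + (c\<^sub>0 - c\<^sub>1) * \<sigma>)"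
      using \<epsilon> c01 \<nu> by simp
    finally show ?thesis using True False by simp
  next
    case True': True
    have "(1 - \<epsilon>) * t \<le> (1 - \<epsilon>) * \<sigma>" using True' \<epsilon> by (intro mult_left_mono) auto
    then have "(1 - \<epsilon>) * t \<le> ?w" using \<epsilon>\<nu> by linarith
    then have "chi ?w - chi \<sigma> \<le> c\<^sub>2 * (?w - \<sigma>)"
      unfolding c using \<epsilon> pos by (intro slope_ge[OF _ _ w_le]) auto
    also have "\<dots> = \<epsilon> * (c\<^sub>0 * (\<nu> - \<sigma>) - (c\<^sub>2 - c\<^sub>0) * (\<sigma> - \<nu>))"
      unfolding w\<sigma> by (simp add: algebra_simps)
    also have "\<dots> \<le> \<epsilon> * (c\<^sub>0 * (\<nu> - \<sigma>) + (c\<^sub>0 - c\<^sub>1) * \<sigma> - (c\<^sub>2 - c\<^sub>0) * (t - M))"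
    proof (intro mult_left_mono)
      have "(c\<^sub>2 - c\<^sub>0) * (t - M) \<le> (c\<^sub>2 - c\<^sub>0) * (\<sigma> - \<nu>)"
        using c(4) True' \<nu> by (intro mult_left_mono) auto
      moreover have "0 \<le> (c\<^sub>0 - c\<^sub>1) * \<sigma>" using c01 \<sigma> by simp
      ultimately show "c\<^sub>0 * (\<nu> - \<sigma>) - (c\<^sub>2 - c\<^sub>0) * (\<sigma> - \<nu>)
          \<le> c\<^sub>0 * (\<nu> - \<sigma>) + (c\<^sub>0 - c\<^sub>1) * \<sigma> - (c\<^sub>2 - c\<^sub>0) * (t - M)" by linarith
    qed (use \<epsilon> in simp)
    finally show ?thesis using True True' by simp
  qed
qed

end

lemma esssup_restrict_bounded_nonneg:
  fixes a b :: real
  assumes "a < b" and meas: "\<sigma>h \<in> borel_measurable borel"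
    and nonneg: "\<And>x. x \<in> {a<..<b} \<Longrightarrow> 0 \<le> \<sigma>h x"
    and bdd: "\<exists>M. AE x in lborel. x \<in> {a<..<b} \<longrightarrow> \<sigma>h x \<le> M"
  obtains M where "esssup (restrict_space lborel {a<..<b}) (\<lambda>y. ereal (\<sigma>h y)) = ereal M"
    "0 \<le> M" "AE x in lborel. x \<in> {a<..<b} \<longrightarrow> \<sigma>h x \<le> M"
proof -
  let ?R = "restrict_space lborel {a<..<b}"
  let ?E = "esssup ?R (\<lambda>y. ereal (\<sigma>h y))"
  note AE_R = AE_restrict_space_iff[of "{a<..<b}" "lborel :: real measure", simplified]
  have [measurable]: "(\<lambda>y. ereal (\<sigma>h y)) \<in> borel_measurable ?R"
    using meas by (intro measurable_restrict_space1) simp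
  obtain M0 where M0: "AE x in lborel. x \<in> {a<..<b} \<longrightarrow> \<sigma>h x \<le> M0" using bdd by blast
  have upper: "?E \<le> ereal M0"
    by (rule esssup_I) (use M0 in \<open>simp_all add: AE_R\<close>)
  have E: "AE x in lborel. x \<in> {a<..<b} \<longrightarrow> ereal (\<sigma>h x) \<le> ?E"
    using esssup_AE[of "\<lambda>y. ereal (\<sigma>h y)" ?R] by (simp add: AE_R)
  have lower: "0 \<le> ?E"
  proof (rule ccontr)
    assume neg: "\<not> 0 \<le> ?E"
    have "AE x in lborel. x \<notin> {a<..<b}"
      using E
    proof eventually_elim
      case (elim x)
      then show ?case using neg nonneg[of x]
        by (metis ereal_less_eq(5) order_trans)
    qed
    then have "emeasure lborel {a<..<b} = 0"
      by (subst (asm) AE_iff_measurable[of "{a<..<b}"]) auto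
    then show False using assms(1) by simp
  qed
  obtain M where M: "?E = ereal M" using upper lower by (cases ?E) auto
  show ?thesis
    using that[OF M] lower E M by simp
qed

lemma not_AE_le_imp_gap:
  fixes f :: "'a \<Rightarrow> real"
  assumes "\<not> (AE x in N. f x \<le> M)"
  obtains t where "M < t" "\<not> (AE x in N. f x \<le> t)"
proof (rule ccontr)
  assume "\<not> thesis"
  then have "AE x in N. f x \<le> M + inverse (real (Suc k))" for k
    using that[of "M + inverse (real (Suc k))"] by auto
  then have "AE x in N. \<forall>k. f x \<le> M + inverse (real (Suc k))"
    by (simp add: AE_all_countable)
  then have "AE x in N. f x \<le> M"
  proof eventually_elim
    case (elim x)
    show ?case
    proof (rule ccontr)
      assume "\<not> f x \<le> M"
      then obtain k where "inverse (real (Suc k)) < f x - M"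
        using reals_Archimedean[of "f x - M"] by auto
      then show False using elim by (smt (verit))
    qed
  qed
  with assms show False by contradiction
qed

lemma diffusion_minimiser_le:
  fixes a b M \<tau> :: real and chi chi' chi'' :: "real \<Rightarrow> real"
    and \<rho>h \<eta>h \<rho> \<eta> :: "real \<Rightarrow> real"
  assumes chi_cont: "continuous_on {0..} chi"
    and chi_d1: "\<And>h. 0 < h \<Longrightarrow> (chi has_real_derivative chi' h) (at h)"
    and chi_d2: "\<And>h. 0 < h \<Longrightarrow> (chi' has_real_derivative chi'' h) (at h)"
    and chi_convex: "\<And>h. 0 < h \<Longrightarrow> 0 < chi'' h"
    and chi_d1_lim: "(chi' \<longlongrightarrow> 0) (at_right 0)"
    and tau: "0 < \<tau>"
    and \<rho>h: "adm_density {a<..<b} (integral\<^sup>L lborel \<rho>h) \<rho>h"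
    and \<eta>h: "adm_density {a<..<b} (integral\<^sup>L lborel \<eta>h) \<eta>h"
    and M: "0 \<le> M" "AE x in lborel. \<rho>h x + \<eta>h x \<le> M"
    and minimiser: "is_diffusion_minimiser chi {a<..<b} \<tau> \<rho>h \<eta>h \<rho> \<eta>"
  shows "AE x in lborel. \<rho> x + \<eta> x \<le> M"
proof (rule ccontr)
  let ?\<Omega> = "{a<..<b}"
  note chi_assms = chi_cont chi_d1 chi_d2 chi_convex
  define \<sigma> where "\<sigma> x = \<rho> x + \<eta> x" for x
  assume "\<not> (AE x in lborel. \<rho> x + \<eta> x \<le> M)"
  then obtain t where t: "M < t" "\<not> (AE x in lborel. \<sigma> x \<le> t)"
    using not_AE_le_imp_gap[of \<sigma> M lborel] unfolding \<sigma>_def by blast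
  define s where "s = (M + t) / 2"
  have s: "M < s" "s < t" using t(1) by (auto simp: s_def)
  have adm: "adm_density ?\<Omega> (integral\<^sup>L lborel \<rho>h) \<rho>" "adm_density ?\<Omega> (integral\<^sup>L lborel \<eta>h) \<eta>"
    and fin: "energy_finite chi ?\<Omega> \<rho> \<eta>"
    using minimiser by (auto simp: is_diffusion_minimiser_def)
  have [measurable]: "\<rho> \<in> borel_measurable borel" "\<eta> \<in> borel_measurable borel"
    using adm by (auto simp: adm_density_def)
  then have \<sigma>_meas[measurable]: "\<sigma> \<in> borel_measurable borel"
    unfolding \<sigma>_def[abs_def] by measurable
  have \<sigma>_nonneg: "0 \<le> \<sigma> x" for x
    using adm by (simp add: adm_density_def \<sigma>_def)
  have \<sigma>_0: "\<sigma> x = 0" if "x \<notin> ?\<Omega>" for x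
    using adm that by (simp add: adm_density_def \<sigma>_def)
  have \<rho>_int: "integrable lborel \<rho>" and \<eta>_int: "integrable lborel \<eta>"
    using adm by (auto simp: adm_density_def)

  define A where "A = {x. s < \<sigma> x}"
  define A' where "A' = {x. t < \<sigma> x}"
  have [measurable]: "A \<in> sets borel" "A' \<in> sets borel"
    unfolding A_def A'_def by measurable
  have A'_sub: "A' \<subseteq> ?\<Omega>"
    using \<sigma>_0 t(1) M(1) by (force simp: A'_def)
  have A'_fin: "emeasure lborel A' < \<infinity>"
    using bounded_subset[OF _ A'_sub] by (intro emeasure_bounded_finite) simp
  define L where "L = measure lborel A'"
  have "emeasure lborel A' \<noteq> 0"
    using t(2) by (subst (asm) AE_iff_measurable[of A']) (auto simp: A'_def not_le)
  then have L: "0 < L"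
    using A'_fin by (simp add: L_def measure_def enn2real_positive_iff zero_less_iff_neq_zero)
  define S where "S = (\<integral>x. indicator A x * \<sigma> x \<partial>lborel)"

  obtain \<epsilon> where \<epsilon>: "0 < \<epsilon>" "\<epsilon> < 1"
    and \<epsilon>_gain: "(chi' (s + \<epsilon> * M) - chi' ((1 - \<epsilon>) * s)) * S
       < (chi' ((1 - \<epsilon>) * t) - chi' (s + \<epsilon> * M)) * ((t - M) * L)"
    using exists_decreasing_fraction[OF chi_assms M(1) s L, of S] by blast
  define c0 where "c0 = chi' (s + \<epsilon> * M)"
  define c1 where "c1 = chi' ((1 - \<epsilon>) * s)"
  define c2 where "c2 = chi' ((1 - \<epsilon>) * t)"
  have S_nonneg: "0 \<le> S"
    unfolding S_def using \<sigma>_nonneg by (intro integral_nonneg_AE) auto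
  have c01: "c1 \<le> c0"
  proof -
    have "0 \<le> \<epsilon> * s" "0 \<le> \<epsilon> * M" "0 < s" using \<epsilon> M s by auto
    then show ?thesis
      unfolding c0_def c1_def using \<epsilon>
      by (intro deriv_mono[OF chi_assms]) (auto simp: algebra_simps)
  qed
  have "0 < (c2 - c0) * ((t - M) * L)"
    using \<epsilon>_gain c01 S_nonneg unfolding c0_def c1_def c2_def
    by (smt (verit) mult_nonneg_nonneg)
  then have c02: "c0 \<le> c2"
    using t(1) L by (auto simp: zero_less_mult_iff mult_less_0_iff)
  define \<kappa> where "\<kappa> = \<epsilon> * ((c2 - c0) * ((t - M) * L) - (c0 - c1) * S)"
  have \<kappa>: "0 < \<kappa>"
    using \<epsilon>_gain \<epsilon> by (simp add: \<kappa>_def c0_def c1_def c2_def)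
  define \<delta> where "\<delta> = \<tau> * \<kappa> / 2"
  have \<delta>: "0 < \<delta>" using tau \<kappa> by (simp add: \<delta>_def)

  let ?new = "\<lambda>f n x. (1 - \<epsilon> * indicator A x) * f x + \<epsilon> * n x"
  obtain n1 where n1: "n1 \<in> borel_measurable borel" "\<And>x. 0 \<le> n1 x" "\<And>x. n1 x \<le> \<rho>h x"
    "integrable lborel n1" "integral\<^sup>L lborel n1 = (\<integral>x. indicator A x * \<rho> x \<partial>lborel)"
    "adm_density ?\<Omega> (integral\<^sup>L lborel \<rho>h) (?new \<rho> n1)"
    "W2sq (dens ?\<Omega> (?new \<rho> n1)) (dens ?\<Omega> \<rho>h) \<le> W2sq (dens ?\<Omega> \<rho>) (dens ?\<Omega> \<rho>h) + \<delta>"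
    using move_mass_to_target[OF adm(1) \<rho>h, of A \<epsilon> \<delta>] \<epsilon> \<delta> by (auto simp: less_imp_le)
  obtain n2 where n2: "n2 \<in> borel_measurable borel" "\<And>x. 0 \<le> n2 x" "\<And>x. n2 x \<le> \<eta>h x"
    "integrable lborel n2" "integral\<^sup>L lborel n2 = (\<integral>x. indicator A x * \<eta> x \<partial>lborel)"
    "adm_density ?\<Omega> (integral\<^sup>L lborel \<eta>h) (?new \<eta> n2)"
    "W2sq (dens ?\<Omega> (?new \<eta> n2)) (dens ?\<Omega> \<eta>h) \<le> W2sq (dens ?\<Omega> \<eta>) (dens ?\<Omega> \<eta>h) + \<delta>"
    using move_mass_to_target[OF adm(2) \<eta>h, of A \<epsilon> \<delta>] \<epsilon> \<delta> by (auto simp: less_imp_le)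
  define \<nu> where "\<nu> x = n1 x + n2 x" for x
  define w where "w x = (1 - \<epsilon> * indicator A x) * \<sigma> x + \<epsilon> * \<nu> x" for x
  have w_eq: "?new \<rho> n1 x + ?new \<eta> n2 x = w x" for x
    by (simp add: w_def \<sigma>_def \<nu>_def algebra_simps)
  have [measurable]: "n1 \<in> borel_measurable borel" "n2 \<in> borel_measurable borel"
    using n1 n2 by auto
  have [measurable]: "\<nu> \<in> borel_measurable borel" "w \<in> borel_measurable borel"
    unfolding \<nu>_def[abs_def] w_def[abs_def] by measurable
  have \<nu>_nonneg: "0 \<le> \<nu> x" for x using n1(2) n2(2) by (simp add: \<nu>_def)
  have \<nu>_le: "AE x in lborel. \<nu> x \<le> M"
    using M(2)
  proof eventually_elim
    case (elim x)
    then show ?case using n1(3)[of x] n2(3)[of x] by (simp add: \<nu>_def)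
  qed
  have \<nu>_0: "\<nu> x = 0" if "x \<notin> ?\<Omega>" for x
    using n1(2,3)[of x] n2(2,3)[of x] \<rho>h \<eta>h that by (simp add: adm_density_def \<nu>_def)
  have A_int: "integrable lborel (\<lambda>x. indicator A x * \<rho> x)" "integrable lborel (\<lambda>x. indicator A x * \<eta> x)"
    using \<rho>_int \<eta>_int integrable_mult_indicator[of A lborel \<rho>] integrable_mult_indicator[of A lborel \<eta>]
    by auto
  then have A\<sigma>_int: "integrable lborel (\<lambda>x. indicator A x * \<sigma> x)"
    by (simp add: \<sigma>_def distrib_left)
  have \<nu>_int: "integrable lborel \<nu>" "integral\<^sup>L lborel \<nu> = S"
    using n1(4,5) n2(4,5) A_int by (simp_all add: \<nu>_def[abs_def] S_def \<sigma>_def distrib_left)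

  have w_nonneg: "0 \<le> w x" for x
    using \<epsilon> \<sigma>_nonneg[of x] \<nu>_nonneg[of x] by (auto simp: w_def indicator_def)
  note chi_mono = energy_density_mono[OF chi_assms chi_d1_lim]
  have chi_borel: "(\<lambda>x. indicator ?\<Omega> x *\<^sub>R chi (u x)) \<in> borel_measurable lborel"
    if [measurable]: "u \<in> borel_measurable borel" and "\<And>x. 0 \<le> u x" for u :: "real \<Rightarrow> real"
  proof -
    have "(\<lambda>y. indicator {0..} y *\<^sub>R chi y) \<in> borel_measurable borel"
      by (rule borel_measurable_continuous_on_indicator[OF _ chi_cont]) simp
    then have "(\<lambda>x. indicator {0..} (u x) *\<^sub>R chi (u x)) \<in> borel_measurable borel"
      by (rule measurable_compose[OF that(1)])
    then have [measurable]: "(\<lambda>x. chi (u x)) \<in> borel_measurable borel"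
      using that(2) by simp
    show ?thesis by simp
  qed
  have \<sigma>_en: "integrable lborel (\<lambda>x. indicator ?\<Omega> x *\<^sub>R chi (\<sigma> x))"
    using fin by (simp add: energy_finite_def set_integrable_def \<sigma>_def)
  have w_en: "integrable lborel (\<lambda>x. indicator ?\<Omega> x *\<^sub>R chi (w x))"
  proof (rule Bochner_Integration.integrable_bound)
    let ?B = "\<lambda>x. \<bar>indicator ?\<Omega> x *\<^sub>R chi (\<sigma> x)\<bar>
        + indicator ?\<Omega> x *\<^sub>R (\<bar>chi 0\<bar> + \<bar>chi (s + M)\<bar>)"
    have "integrable lborel (indicator ?\<Omega> :: real \<Rightarrow> real)"
      by (intro integrable_real_indicator emeasure_bounded_finite) simp_all
    then show "integrable lborel ?B"
      using \<sigma>_en by (intro Bochner_Integration.integrable_add integrable_abs) auto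
    show "AE x in lborel. norm (indicator ?\<Omega> x *\<^sub>R chi (w x)) \<le> norm (?B x)"
      using \<nu>_le
    proof eventually_elim
      case (elim x)
      have \<epsilon>\<nu>: "\<epsilon> * \<nu> x \<le> \<nu> x" using \<epsilon> \<nu>_nonneg[of x] by (simp add: mult_left_le_one_le)
      have lo: "chi 0 \<le> chi (w x)" using chi_mono[of 0 "w x"] w_nonneg by simp
      have hi: "chi (w x) \<le> chi (\<sigma> x) \<or> chi (w x) \<le> chi (s + M)"
      proof (cases "x \<in> A")
        case True
        then have "\<epsilon> * \<nu> x \<le> \<epsilon> * \<sigma> x"
          using elim s \<epsilon> by (intro mult_left_mono) (auto simp: A_def)
        then have "w x \<le> \<sigma> x" using True by (simp add: w_def algebra_simps)
        then show ?thesis using chi_mono[of "w x" "\<sigma> x"] w_nonneg by simp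
      next
        case False
        then have "w x \<le> s + M" using elim \<epsilon>\<nu> by (simp add: w_def A_def)
        then show ?thesis using chi_mono[of "w x" "s + M"] w_nonneg by simp
      qed
      show ?case using lo hi by (auto simp: indicator_def)
    qed
  qed (rule chi_borel; use w_nonneg in simp)
  have w_fin: "energy_finite chi ?\<Omega> (?new \<rho> n1) (?new \<eta> n2)"
    unfolding energy_finite_def set_integrable_def w_eq by (rule w_en)

  let ?G = "\<lambda>x. \<epsilon> * (c0 * (\<nu> x - indicator A x * \<sigma> x) + (c0 - c1) * (indicator A x * \<sigma> x)
      - (c2 - c0) * (t - M) * indicator A' x)"
  have A'_int: "integrable lborel (indicator A' :: real \<Rightarrow> real)"
    using A'_fin by (simp add: integrable_indicator_iff)
  have G_int: "integrable lborel ?G"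
    using \<nu>_int A\<sigma>_int A'_int by (intro integrable_mult_right Bochner_Integration.integrable_diff
        Bochner_Integration.integrable_add) auto
  have G_eq: "integral\<^sup>L lborel ?G = - \<kappa>"
  proof -
    have "integral\<^sup>L lborel ?G = \<epsilon> * (c0 * (S - S) + (c0 - c1) * S - (c2 - c0) * (t - M) * L)"
      using \<nu>_int A\<sigma>_int A'_int by (simp add: S_def L_def)
    then show ?thesis by (simp add: \<kappa>_def algebra_simps)
  qed
  have "energy chi ?\<Omega> (?new \<rho> n1) (?new \<eta> n2) - energy chi ?\<Omega> \<rho> \<eta>
      = (\<integral>x. indicator ?\<Omega> x *\<^sub>R chi (w x) - indicator ?\<Omega> x *\<^sub>R chi (\<sigma> x) \<partial>lborel)"
    unfolding energy_def set_lebesgue_integral_def w_eq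
    using w_en \<sigma>_en by (simp add: \<sigma>_def)
  also have "\<dots> \<le> integral\<^sup>L lborel ?G"
  proof (rule integral_mono_AE)
    show "AE x in lborel. indicator ?\<Omega> x *\<^sub>R chi (w x) - indicator ?\<Omega> x *\<^sub>R chi (\<sigma> x) \<le> ?G x"
      using \<nu>_le
    proof eventually_elim
      case (elim x)
      show ?case
      proof (cases "x \<in> ?\<Omega>")
        case True
        then show ?thesis
          using pointwise_energy_change[OF chi_assms M(1) s \<epsilon> \<nu>_nonneg elim \<sigma>_nonneg[of x]
              c0_def c1_def c2_def c02]
          by (simp add: w_def A_def A'_def indicator_def)
      next
        case False
        then have "x \<notin> A'" using A'_sub by auto
        then show ?thesis using False \<sigma>_0 \<nu>_0 by simp
      qed
    qed
  qed (use w_en \<sigma>_en G_int in auto)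
  finally have dE: "energy chi ?\<Omega> (?new \<rho> n1) (?new \<eta> n2) \<le> energy chi ?\<Omega> \<rho> \<eta> - \<kappa>"
    using G_eq by simp
  have "JKO_functional chi ?\<Omega> \<tau> \<rho>h \<eta>h \<rho> \<eta> \<le> JKO_functional chi ?\<Omega> \<tau> \<rho>h \<eta>h (?new \<rho> n1) (?new \<eta> n2)"
    using minimiser n1(6) n2(6) w_fin unfolding is_diffusion_minimiser_def by blast
  also have "\<dots> \<le> (W2sq (dens ?\<Omega> \<rho>) (dens ?\<Omega> \<rho>h) + W2sq (dens ?\<Omega> \<eta>) (dens ?\<Omega> \<eta>h) + 2 * \<delta>) / (2 * \<tau>)
      + (energy chi ?\<Omega> \<rho> \<eta> - \<kappa>)"
    unfolding JKO_functional_def using n1(7) n2(7) dE tau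
    by (intro add_mono[OF divide_right_mono]) auto
  also have "\<dots> = JKO_functional chi ?\<Omega> \<tau> \<rho>h \<eta>h \<rho> \<eta> - \<kappa> / 2"
    using tau by (simp add: JKO_functional_def \<delta>_def add_divide_distrib)
  finally show False using \<kappa> by simp
qed

theorem mainTheorem7:
  fixes a b \<tau> :: real and chi chi' chi'' :: "real \<Rightarrow> real"
    and rh \<sigma>h \<rho>1 \<eta>1 T :: "real \<Rightarrow> real"
  assumes ab: "a < b"
    and chi_cont: "continuous_on {0..} chi"
    and chi_d1: "\<And>h. 0 < h \<Longrightarrow> (chi has_real_derivative chi' h) (at h)"
    and chi_d2: "\<And>h. 0 < h \<Longrightarrow> (chi' has_real_derivative chi'' h) (at h)"
    and chi_d2_cont: "continuous_on {0<..} chi''"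
    and chi_convex: "\<And>h. 0 < h \<Longrightarrow> 0 < chi'' h"
    and chi_d1_lim: "(chi' \<longlongrightarrow> 0) (at_right 0)"
    and kappa_ex: "\<And>x. 0 < x \<Longrightarrow> interval_lebesgue_integrable lborel (ereal 1) (ereal x) (\<lambda>s. chi'' s / s)"
    and K_ex: "\<And>\<sigma>. 0 < \<sigma> \<Longrightarrow> set_integrable lborel {0<..\<sigma>} (kappa chi'')"
    and tau: "0 < \<tau>" "\<tau> < 1"
    and sigma_meas: "\<sigma>h \<in> borel_measurable lborel"
    and sigma_nonneg: "\<And>x. x \<in> {a<..<b} \<Longrightarrow> 0 \<le> \<sigma>h x"
    and sigma_Linf: "\<exists>M. AE x in lborel. x \<in> {a<..<b} \<longrightarrow> \<sigma>h x \<le> M"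
    and r_meas: "rh \<in> borel_measurable lborel"
    and r_bounds: "\<And>x. x \<in> {a<..<b} \<Longrightarrow> 0 \<le> rh x \<and> rh x \<le> 1"
    and minimiser: "is_diffusion_minimiser chi {a<..<b} \<tau>
        (\<lambda>x. indicator {a<..<b} x * (rh x * \<sigma>h x))
        (\<lambda>x. indicator {a<..<b} x * ((1 - rh x) * \<sigma>h x)) \<rho>1 \<eta>1"
    and T_meas: "T \<in> borel_measurable lborel"
    and T_mono: "mono_on {a<..<b} T"
    and T_into: "T ` {a<..<b} \<subseteq> {a<..<b}"
    and T_push: "distr (dens {a<..<b} (\<lambda>x. \<rho>1 x + \<eta>1 x)) lborel T = dens {a<..<b} \<sigma>h"
  shows "(AE x in lborel. x \<in> {a<..<b} \<longrightarrow>
            0 \<le> \<rho>1 x + \<eta>1 x \<and>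
            ereal (\<rho>1 x + \<eta>1 x) \<le> esssup (restrict_space lborel {a<..<b}) (\<lambda>y. ereal (\<sigma>h y)))
         \<and> (\<forall>x \<in> {a<..<b}. 0 \<le> rh (T x) \<and> rh (T x) \<le> 1)"
proof -
  let ?\<Omega> = "{a<..<b}"
  let ?\<rho>h = "\<lambda>x. indicator ?\<Omega> x * (rh x * \<sigma>h x)"
  let ?\<eta>h = "\<lambda>x. indicator ?\<Omega> x * ((1 - rh x) * \<sigma>h x)"
  have [measurable]: "\<sigma>h \<in> borel_measurable borel" "rh \<in> borel_measurable borel"
    using sigma_meas r_meas by auto
  obtain M where M: "esssup (restrict_space lborel ?\<Omega>) (\<lambda>y. ereal (\<sigma>h y)) = ereal M"
      "0 \<le> M" "AE x in lborel. x \<in> ?\<Omega> \<longrightarrow> \<sigma>h x \<le> M"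
    using esssup_restrict_bounded_nonneg[OF ab _ sigma_nonneg sigma_Linf] sigma_meas by auto
  have adm: "adm_density ?\<Omega> (integral\<^sup>L lborel (\<lambda>x. indicator ?\<Omega> x * (q x * \<sigma>h x)))
      (\<lambda>x. indicator ?\<Omega> x * (q x * \<sigma>h x))"
    if [measurable]: "q \<in> borel_measurable borel" and q: "\<And>x. x \<in> ?\<Omega> \<Longrightarrow> 0 \<le> q x \<and> q x \<le> 1" for q
  proof -
    have "integrable lborel (\<lambda>x. indicator ?\<Omega> x * (q x * \<sigma>h x))"
    proof (rule Bochner_Integration.integrable_bound)
      have "integrable lborel (indicator ?\<Omega> :: real \<Rightarrow> real)"
        by (intro integrable_real_indicator emeasure_bounded_finite) simp_all
      then show "integrable lborel (\<lambda>x. indicator ?\<Omega> x * M)" by simp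
      show "AE x in lborel. norm (indicator ?\<Omega> x * (q x * \<sigma>h x)) \<le> norm (indicator ?\<Omega> x * M)"
        using M(3)
      proof eventually_elim
        case (elim x)
        have "q x * \<sigma>h x \<le> 1 * M" if "x \<in> ?\<Omega>"
          using q[OF that] elim that sigma_nonneg[OF that] by (intro mult_mono) auto
        then show ?case
          using q[of x] sigma_nonneg[of x] M(2) by (auto simp: indicator_def)
      qed
    qed simp
    then show ?thesis
      unfolding adm_density_def using q sigma_nonneg by (auto simp: indicator_def)
  qed
  have "AE x in lborel. ?\<rho>h x + ?\<eta>h x \<le> M"
    using M(3) by eventually_elim (use M(2) in \<open>auto simp: indicator_def algebra_simps\<close>)
  then have "AE x in lborel. \<rho>1 x + \<eta>1 x \<le> M"
    using r_bounds by (intro diffusion_minimiser_le[OF chi_cont chi_d1 chi_d2 chi_convex chi_d1_lim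
          tau(1) adm adm M(2) _ minimiser]) auto
  moreover have "0 \<le> \<rho>1 x + \<eta>1 x" for x
    using minimiser by (simp add: is_diffusion_minimiser_def adm_density_def)
  moreover have "\<forall>x \<in> ?\<Omega>. 0 \<le> rh (T x) \<and> rh (T x) \<le> 1"
    using r_bounds T_into by blast
  ultimately show ?thesis
    unfolding M(1) by auto
qed

end
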